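(* Let $n\ge 1$, let $S$ and $R$ be nonempty subsets of $\{0,1\}^n$, and let $w$ be a positive integer. Then the following conditions are equivalent: (1) Player I has a winning strategy in the game $\mathrm{EF}_w(S,R)$. (2) There is a propositional formula $\phi$ of size $\mathrm{w}(\phi)\le w$ such that $(S,R)\models\phi$.
   Context: Fix $n\ge 1$. Strings are elements $s=s_1\ldots s_n$ of $\{0,1\}^n$; a string property is a nonempty set of strings. Propositional formulas are built from the propositional symbols $p_1,\ldots,p_n$ by $\neg,\wedge,\vee$. Satisfaction: $s\models p_i$ iff $s_i=1$, and $\neg,\wedge,\vee$ are interpreted as usual. Size: $\mathrm{w}(p_i)=1$, $\mathrm{w}(\neg\phi)=\mathrm{w}(\phi)$, $\mathrm{w}(\phi\vee\psi)=\mathrm{w}(\phi\wedge\psi)=\mathrm{w}(\phi)+\mathrm{w}(\psi)$. Separation: for sets of strings $S,R$, $(S,R)\models\phi$ means $s\models\phi$ for all $s\in S$ and $r\not\models\phi$ for all $r\in R$. The game $\mathrm{EF}_w(S,R)$ ($w$ a positive integer, called the rank) has two players, I and II. Positions are triples $(w_m,S_m,R_m)$ with $w_m$ a positive integer and $S_m,R_m$ sets of strings (the parts produced by splitting moves may be empty). The initial position is $(w,S,R)$. If in position $(w_m,S_m,R_m)$ there is $i$ with $(S_m,R_m)\models p_i$ or $(S_m,R_m)\models\neg p_i$, the game ends and player I wins. Otherwise, if $w_m=1$, the game ends and player II wins. Otherwise player I makes one of the following moves. Left splitting move: player I chooses integers $u,v\ge 1$ with $u+v=w_m$ and sets $C,D$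 with $S_m=C\cup D$; player II chooses whether the game continues from $(u,C,R_m)$ or from $(v,D,R_m)$. Right splitting move: player I chooses integers $u,v\ge 1$ with $u+v=w_m$ and sets $C,D$ with $R_m=C\cup D$; player II chooses whether the game continues from $(u,S_m,C)$ or from $(v,S_m,D)$. *)

theory Defs
  imports Main
begin

type_synonym bitstring = "bool list"

definition bitstrings :: "nat \<Rightarrow> bitstring set" where
  "bitstrings n = {s. length s = n}"

datatype formula =
    Prop nat
  | Neg formula
  | And formula formula
  | Or formula formula

fun symbols :: "formula \<Rightarrow> nat set" where
  "symbols (Prop i) = {i}"
| "symbols (Neg \<phi>) = symbols \<phi>"
| "symbols (And \<phi> \<psi>) = symbols \<phi> \<union> symbols \<psi>"
| "symbols (Or \<phi> \<psi>) = symbols \<phi> \<union> symbols \<psi>"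

definition formulas :: "nat \<Rightarrow> formula set" where
  "formulas n = {\<phi>. symbols \<phi> \<subseteq> {1..n}}"

text \<open>Propositional symbols are numbered from 1, list positions from 0.\<close>

fun sat :: "bitstring \<Rightarrow> formula \<Rightarrow> bool" where
  "sat s (Prop i) \<longleftrightarrow> s ! (i - 1)"
| "sat s (Neg \<phi>) \<longleftrightarrow> \<not> sat s \<phi>"
| "sat s (And \<phi> \<psi>) \<longleftrightarrow> sat s \<phi> \<and> sat s \<psi>"
| "sat s (Or \<phi> \<psi>) \<longleftrightarrow> sat s \<phi> \<or> sat s \<psi>"

fun weight :: "formula \<Rightarrow> nat" where
  "weight (Prop i) = 1"
| "weight (Neg \<phi>) = weight \<phi>"
| "weight (And \<phi> \<psi>) = weight \<phi> + weight \<psi>"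
| "weight (Or \<phi> \<psi>) = weight \<phi> + weight \<psi>"

definition separates :: "bitstring set \<Rightarrow> bitstring set \<Rightarrow> formula \<Rightarrow> bool" where
  "separates S R \<phi> \<longleftrightarrow> (\<forall>s\<in>S. sat s \<phi>) \<and> (\<forall>r\<in>R. \<not> sat r \<phi>)"

type_synonym position = "nat \<times> bitstring set \<times> bitstring set"

datatype move =
    Left_Split nat nat "bitstring set" "bitstring set"
  | Right_Split nat nat "bitstring set" "bitstring set"

fun won_I :: "nat \<Rightarrow> position \<Rightarrow> bool" where
  "won_I n (w, S, R) \<longleftrightarrow>
     (\<exists>i\<in>{1..n}. separates S R (Prop i) \<or> separates S R (Neg (Prop i)))"

fun won_II :: "nat \<Rightarrow> position \<Rightarrow> bool" where
  "won_II n (w, S, R) \<longleftrightarrow> \<not> won_I n (w, S, R) \<and> w = 1"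

definition ended :: "nat \<Rightarrow> position \<Rightarrow> bool" where
  "ended n p \<longleftrightarrow> won_I n p \<or> won_II n p"

fun legal_move :: "position \<Rightarrow> move \<Rightarrow> bool" where
  "legal_move (w, S, R) (Left_Split u v C D) \<longleftrightarrow>
     u \<ge> 1 \<and> v \<ge> 1 \<and> u + v = w \<and> S = C \<union> D"
| "legal_move (w, S, R) (Right_Split u v C D) \<longleftrightarrow>
     u \<ge> 1 \<and> v \<ge> 1 \<and> u + v = w \<and> R = C \<union> D"

text \<open>The two positions offered to player II by a move of player I.\<close>

fun options :: "position \<Rightarrow> move \<Rightarrow> position set" where
  "options (w, S, R) (Left_Split u v C D) = {(u, C, R), (v, D, R)}"
| "options (w, S, R) (Right_Split u v C D) = {(u, S, C), (v, S, D)}"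

text \<open>
  A strategy of player I may depend on the whole history, given as the nonempty list of
  the positions visited so far, the current position last.
\<close>

type_synonym strategy = "position list \<Rightarrow> move"

text \<open>
  The finite, possibly incomplete, plays from \<open>p\<^sub>0\<close> in which player I follows \<open>\<sigma>\<close>.
\<close>

inductive play :: "nat \<Rightarrow> strategy \<Rightarrow> position \<Rightarrow> position list \<Rightarrow> bool"
  for n \<sigma> p\<^sub>0 where
  start: "play n \<sigma> p\<^sub>0 [p\<^sub>0]"
| step: "play n \<sigma> p\<^sub>0 (h @ [p]) \<Longrightarrow> \<not> ended n p \<Longrightarrow> q \<in> options p (\<sigma> (h @ [p]))
    \<Longrightarrow> play n \<sigma> p\<^sub>0 (h @ [p, q])"

text \<open>
  A winning strategy prescribes a legal move whenever the game has not ended, and never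
  leads to a win of player II. Since legal moves lower the rank
  (\<open>options_rank_less\<close>), there are no infinite plays, so this means that every
  play in which player I follows the strategy ends with a win of player I.
\<close>

definition winning_strategy :: "nat \<Rightarrow> position \<Rightarrow> strategy \<Rightarrow> bool" where
  "winning_strategy n p\<^sub>0 \<sigma> \<longleftrightarrow>
     (\<forall>h p. play n \<sigma> p\<^sub>0 (h @ [p]) \<longrightarrow>
        (if ended n p then won_I n p else legal_move p (\<sigma> (h @ [p]))))"

lemma options_rank_less:
  assumes "legal_move p m" and "q \<in> options p m"
  shows "1 \<le> fst q \<and> fst q < fst p"
  using assms by (cases p; cases m) auto

end

theory Submission
  imports Defs
begin

text \<open>
  Both directions trade a position \<open>(w, S, R)\<close> for a separating formula of size at most \<open>w\<close>.
  A left (right) splitting move corresponds to a disjunction (conjunction), the rank being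
  distributed over the two subformulas, and negation is handled by exchanging \<open>S\<close> and \<open>R\<close>.
\<close>

text \<open>A predicate on whole positions, so that it can be carried along a play and required of
  every element of \<open>options p m\<close>.\<close>

definition separable :: "nat \<Rightarrow> position \<Rightarrow> bool" where
  "separable n p \<longleftrightarrow> (case p of (w, S, R) \<Rightarrow>
     \<exists>\<phi>\<in>formulas n. weight \<phi> \<le> w \<and> separates S R \<phi>)"

lemma separableI:
  "\<phi> \<in> formulas n \<Longrightarrow> weight \<phi> \<le> w \<Longrightarrow> separates S R \<phi> \<Longrightarrow> separable n (w, S, R)"
  by (auto simp: separable_def)

lemma separableE:
  assumes "separable n (w, S, R)"
  obtains \<phi> where "\<phi> \<in> formulas n" "weight \<phi> \<le> w" "separates S R \<phi>"
  using assms by (auto simp: separable_def)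

lemma formulas_simps [simp]:
  "Prop i \<in> formulas n \<longleftrightarrow> i \<in> {1..n}"
  "Neg \<phi> \<in> formulas n \<longleftrightarrow> \<phi> \<in> formulas n"
  "And \<phi> \<psi> \<in> formulas n \<longleftrightarrow> \<phi> \<in> formulas n \<and> \<psi> \<in> formulas n"
  "Or \<phi> \<psi> \<in> formulas n \<longleftrightarrow> \<phi> \<in> formulas n \<and> \<psi> \<in> formulas n"
  by (auto simp: formulas_def)

lemma weight_pos: "weight \<phi> \<ge> 1"
  by (induction \<phi>) auto

lemma separates_Neg: "separates S R (Neg \<phi>) \<longleftrightarrow> separates R S \<phi>"
  by (auto simp: separates_def)

lemma separates_Or: "separates C R \<phi> \<Longrightarrow> separates D R \<psi> \<Longrightarrow> separates (C \<union> D) R (Or \<phi> \<psi>)"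
  by (auto simp: separates_def)

lemma separates_And: "separates S C \<phi> \<Longrightarrow> separates S D \<psi> \<Longrightarrow> separates S (C \<union> D) (And \<phi> \<psi>)"
  by (auto simp: separates_def)

text \<open>Leading negations cost no weight and only exchange the two sides, so the first other
  symbol below them decides the case. Induction serves to strip these negations. The two weights add
  up exactly, which leaves any slack in the rank to the move.\<close>

lemma separates_cases:
  assumes "\<phi> \<in> formulas n" and "separates S R \<phi>"
  obtains
    (literal) i where "i \<in> {1..n}" "separates S R (Prop i) \<or> separates S R (Neg (Prop i))"
  | (left) \<psi> \<chi> C D where "\<psi> \<in> formulas n" "\<chi> \<in> formulas n" "weight \<psi> + weight \<chi> = weight \<phi>"
      "S = C \<union> D" "separates C R \<psi>" "separates D R \<chi>"
  | (right) \<psi> \<chi> C D where "\<psi> \<in> formulas n" "\<chi> \<in> formulas n" "weight \<psi> + weight \<chi> = weight \<phi>"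
      "R = C \<union> D" "separates S C \<psi>" "separates S D \<chi>"
  using assms
proof (induction \<phi> arbitrary: S R thesis)
  case (Prop i)
  then show ?case by auto
next
  case (Neg \<phi>)
  from Neg.prems have "\<phi> \<in> formulas n" "separates R S \<phi>"
    by (auto simp: separates_Neg)
  then show ?case
  \<comment> \<open>The hypothesis is applied with \<open>S\<close> and \<open>R\<close> exchanged,
    so its left case yields a right split and conversely. The rotation puts the premises on
    \<open>\<phi>\<close> first, to be discharged by the chained facts.\<close>
  proof (rule Neg.IH[rotated 3])
    fix i assume "i \<in> {1..n}" "separates R S (Prop i) \<or> separates R S (Neg (Prop i))"
    then show ?thesis using Neg.prems(1)[of i] by (auto simp: separates_Neg)
  next
    fix \<psi> \<chi> C D
    assume "\<psi> \<in> formulas n" "\<chi> \<in> formulas n" "weight \<psi> + weight \<chi> = weight \<phi>"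
      "R = C \<union> D" "separates C S \<psi>" "separates D S \<chi>"
    then show ?thesis
      using Neg.prems(3)[of "Neg \<psi>" "Neg \<chi>" C D] by (simp add: separates_Neg)
  next
    fix \<psi> \<chi> C D
    assume "\<psi> \<in> formulas n" "\<chi> \<in> formulas n" "weight \<psi> + weight \<chi> = weight \<phi>"
      "S = C \<union> D" "separates R C \<psi>" "separates R D \<chi>"
    then show ?thesis
      using Neg.prems(2)[of "Neg \<psi>" "Neg \<chi>" C D] by (simp add: separates_Neg)
  qed
next
  case (And \<phi> \<psi>)
  show ?case
    \<comment> \<open>A string falsifying a conjunction falsifies some conjunct, so these two parts
      cover \<open>R\<close>; they may overlap or be empty.\<close>
    by (rule And.prems(3)[of \<phi> \<psi> "{r \<in> R. \<not> sat r \<phi>}" "{r \<in> R. \<not> sat r \<psi>}"])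
      (use And.prems(4,5) in \<open>auto simp: separates_def\<close>)
next
  case (Or \<phi> \<psi>)
  show ?case
    by (rule Or.prems(2)[of \<phi> \<psi> "{s \<in> S. sat s \<phi>}" "{s \<in> S. sat s \<psi>}"])
      (use Or.prems(4,5) in \<open>auto simp: separates_def\<close>)
qed

lemma separable_imp_move:
  assumes "separable n p" and "\<not> won_I n p"
  shows "\<exists>m. legal_move p m \<and> (\<forall>q\<in>options p m. separable n q)"
proof -
  obtain w S R where p: "p = (w, S, R)" by (cases p)
  obtain \<phi> where \<phi>: "\<phi> \<in> formulas n" "weight \<phi> \<le> w" "separates S R \<phi>"
    using assms(1) unfolding p by (rule separableE)
  show ?thesis
    using \<phi>(1,3)
  proof (cases rule: separates_cases)
    case (literal i)
    then show ?thesis using assms(2) p by auto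
  next
    case (left \<psi> \<chi> C D)
    then show ?thesis
      using \<phi>(2) weight_pos[of \<psi>] weight_pos[of \<chi>]
      \<comment> \<open>\<open>\<psi>\<close> gets exactly its weight as rank, \<open>\<chi>\<close>
        the rest including the slack; positive weights make both ranks at least 1.\<close>
      by (intro exI[of _ "Left_Split (weight \<psi>) (w - weight \<psi>) C D"])
        (auto simp: p intro: separableI)
  next
    case (right \<psi> \<chi> C D)
    then show ?thesis
      using \<phi>(2) weight_pos[of \<psi>] weight_pos[of \<chi>]
      by (intro exI[of _ "Right_Split (weight \<psi>) (w - weight \<psi>) C D"])
        (auto simp: p intro: separableI)
  qed
qed

text \<open>Otherwise \<open>separable_imp_move\<close> would supply a legal move at rank 1, but 1
  is not a sum of two positive integers.\<close>

lemma separable_imp_not_won_II: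
  assumes "separable n p"
  shows "\<not> won_II n p"
proof
  assume "won_II n p"
  moreover obtain w S R where p: "p = (w, S, R)" by (cases p)
  ultimately have "\<not> won_I n p" "w = 1" by auto
  then obtain m where m: "legal_move p m"
    using separable_imp_move[OF assms] by blast
  then show False using \<open>w = 1\<close> p by (cases m) auto
qed

lemma separable_imp_winning_strategy:
  assumes "separable n p\<^sub>0"
  shows "\<exists>\<sigma>. winning_strategy n p\<^sub>0 \<sigma>"
proof -
  define good where "good p m \<longleftrightarrow> legal_move p m \<and> (\<forall>q\<in>options p m. separable n q)" for p m
  \<comment> \<open>The strategy looks only at the current position. Its value matters only at
    separable positions where the game goes on, and there a good move exists.\<close>
  define \<sigma> :: strategy where "\<sigma> h = (SOME m. good (last h) m)" for h
  have good: "good p (\<sigma> (h @ [p]))" if "separable n p" "\<not> ended n p" for h p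
  proof -
    have "\<exists>m. good p m"
      using separable_imp_move[OF that(1)] that(2) by (simp add: good_def ended_def)
    then show ?thesis by (simp add: \<sigma>_def someI_ex)
  qed
  \<comment> \<open>Separability is an invariant of every play following \<open>\<sigma>\<close>,
    since a good move keeps both options separable.\<close>
  have "separable n (last h)" if "play n \<sigma> p\<^sub>0 h" for h
    using that
  proof induction
    case start
    then show ?case using assms by simp
  next
    case (step h p q)
    then show ?case using good[of p h] by (auto simp: good_def)
  qed
  then have "separable n p" if "play n \<sigma> p\<^sub>0 (h @ [p])" for h p
    using that by fastforce
  then have "winning_strategy n p\<^sub>0 \<sigma>"
    using good separable_imp_not_won_II
    by (auto simp: winning_strategy_def ended_def good_def)
  then show ?thesis by blast
qed

lemma won_I_imp_separable:
  assumes "won_I n p" and "fst p \<ge> 1"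
  shows "separable n p"
proof -
  obtain w S R where p: "p = (w, S, R)" by (cases p)
  with assms obtain i where "i \<in> {1..n}" "w \<ge> 1"
    "separates S R (Prop i) \<or> separates S R (Neg (Prop i))" by auto
  then show ?thesis
    unfolding p by (auto intro: separableI[of "Prop i"] separableI[of "Neg (Prop i)"])
qed

text \<open>Formulas for both options are joined by \<open>Or\<close> after a left split and by
  \<open>And\<close> after a right split; the weight is then at most
  \<open>u + v = w\<close>.\<close>

lemma move_imp_separable:
  assumes "legal_move p m" and "\<And>q. q \<in> options p m \<Longrightarrow> separable n q"
  shows "separable n p"
proof -
  obtain w S R where p: "p = (w, S, R)" by (cases p)
  show ?thesis
  proof (cases m)
    case (Left_Split u v C D)
    with assms p have "separable n (u, C, R)" "separable n (v, D, R)" "u + v = w" "S = C \<union> D"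
      by auto
    then show ?thesis
      unfolding p
      by (elim separableE) (auto intro: separableI[of "Or _ _"] separates_Or)
  next
    case (Right_Split u v C D)
    with assms p have "separable n (u, S, C)" "separable n (v, S, D)" "u + v = w" "R = C \<union> D"
      by auto
    then show ?thesis
      unfolding p
      by (elim separableE) (auto intro: separableI[of "And _ _"] separates_And)
  qed
qed

text \<open>Induction on the rank: player II may pick either option, so both continue a play
  following \<open>\<sigma>\<close> and are separable by hypothesis. The history is kept arbitrary
  because \<open>\<sigma>\<close> may depend on it.\<close>

lemma winning_strategy_imp_separable:
  assumes "winning_strategy n p\<^sub>0 \<sigma>" and "play n \<sigma> p\<^sub>0 (h @ [p])" and "fst p \<ge> 1"
  shows "separable n p"
  using assms(2,3)
proof (induction "fst p" arbitrary: h p rule: less_induct)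
  case less
  show ?case
  proof (cases "ended n p")
    case True
    then have "won_I n p"
      using assms(1) less.prems(1) by (metis winning_strategy_def)
    then show ?thesis using less.prems(2) by (rule won_I_imp_separable)
  next
    case False
    then have legal: "legal_move p (\<sigma> (h @ [p]))"
      using assms(1) less.prems(1) by (metis winning_strategy_def)
    then show ?thesis
    proof (rule move_imp_separable)
      fix q assume q: "q \<in> options p (\<sigma> (h @ [p]))"
      \<comment> \<open>Regrouped so that the induction hypothesis applies with
        \<open>h @ [p]\<close> as the history before \<open>q\<close>.\<close>
      have "play n \<sigma> p\<^sub>0 ((h @ [p]) @ [q])"
        using play.step[OF less.prems(1) False q] by simp
      then show "separable n q"
        using less.hyps options_rank_less[OF legal q] by blast
    qed
  qed
qed

theorem theorem3:
  fixes n w :: nat and S R :: "bitstring set"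
  assumes "n \<ge> 1"
    and "S \<subseteq> bitstrings n" and "S \<noteq> {}"
    and "R \<subseteq> bitstrings n" and "R \<noteq> {}"
    and "w \<ge> 1"
  shows "(\<exists>\<sigma>. winning_strategy n (w, S, R) \<sigma>) \<longleftrightarrow>
         (\<exists>\<phi>\<in>formulas n. weight \<phi> \<le> w \<and> separates S R \<phi>)"
proof -
  have "separable n (w, S, R)" if "winning_strategy n (w, S, R) \<sigma>" for \<sigma>
    using winning_strategy_imp_separable[OF that, of "[]"] play.start \<open>w \<ge> 1\<close> by simp
  then have "(\<exists>\<sigma>. winning_strategy n (w, S, R) \<sigma>) \<longleftrightarrow> separable n (w, S, R)"
    using separable_imp_winning_strategy by blast
  then show ?thesis by (simp add: separable_def)
qed

end
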